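(* The set $\mathbb{H}$ of hybrid numbers, equipped with the commutator bracket $[X,Y]=XY-YX$ (in particular $[h^i,h^j]=h^ih^j-h^jh^i$), is a Lie algebra over $\mathbb{R}$.
   Context: $\mathbb{H}$ denotes the set of hybrid numbers $\{a+b_1h^1+b_2h^2+b_3h^3 : a,b_1,b_2,b_3\in\mathbb{R}\}$, i.e. the real vector space with basis $1,h^1,h^2,h^3$ (superscripts are indices, not powers), with the $\mathbb{R}$-bilinear multiplication having unit $1$ and determined by $h^1h^1=-1$, $h^1h^2=1-h^3$, $h^1h^3=h^1+h^2$, $h^2h^1=1+h^3$, $h^2h^2=0$, $h^2h^3=-h^2$, $h^3h^1=-h^1-h^2$, $h^3h^2=h^2$, $h^3h^3=1$. *)

theory Defs
  imports Complex_Main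
begin

codatatype hybrid = Hybrid (hcomp0: real) (hcomp1: real) (hcomp2: real) (hcomp3: real)

lemma hybrid_eq_iff:
  "X = Y \<longleftrightarrow> hcomp0 X = hcomp0 Y \<and> hcomp1 X = hcomp1 Y \<and> hcomp2 X = hcomp2 Y \<and> hcomp3 X = hcomp3 Y"
  by (auto intro: hybrid.expand)

instantiation hybrid :: real_vector
begin

primcorec zero_hybrid where
  "hcomp0 0 = 0" | "hcomp1 0 = 0" | "hcomp2 0 = 0" | "hcomp3 0 = 0"

primcorec plus_hybrid where
  "hcomp0 (X + Y) = hcomp0 X + hcomp0 Y"
| "hcomp1 (X + Y) = hcomp1 X + hcomp1 Y"
| "hcomp2 (X + Y) = hcomp2 X + hcomp2 Y"
| "hcomp3 (X + Y) = hcomp3 X + hcomp3 Y"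

primcorec uminus_hybrid where
  "hcomp0 (- X) = - hcomp0 X"
| "hcomp1 (- X) = - hcomp1 X"
| "hcomp2 (- X) = - hcomp2 X"
| "hcomp3 (- X) = - hcomp3 X"

primcorec minus_hybrid where
  "hcomp0 (X - Y) = hcomp0 X - hcomp0 Y"
| "hcomp1 (X - Y) = hcomp1 X - hcomp1 Y"
| "hcomp2 (X - Y) = hcomp2 X - hcomp2 Y"
| "hcomp3 (X - Y) = hcomp3 X - hcomp3 Y"

primcorec scaleR_hybrid where
  "hcomp0 (r *\<^sub>R X) = r * hcomp0 X"
| "hcomp1 (r *\<^sub>R X) = r * hcomp1 X"
| "hcomp2 (r *\<^sub>R X) = r * hcomp2 X"
| "hcomp3 (r *\<^sub>R X) = r * hcomp3 X"

instance
  by standard (simp_all add: hybrid_eq_iff algebra_simps)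

end

instantiation hybrid :: one
begin

definition one_hybrid :: hybrid where "1 = Hybrid 1 0 0 0"

instance ..

end

definition h1 :: hybrid where "h1 = Hybrid 0 1 0 0"
definition h2 :: hybrid where "h2 = Hybrid 0 0 1 0"
definition h3 :: hybrid where "h3 = Hybrid 0 0 0 1"

lemma hybrid_basis_expansion:
  "X = hcomp0 X *\<^sub>R 1 + hcomp1 X *\<^sub>R h1 + hcomp2 X *\<^sub>R h2 + hcomp3 X *\<^sub>R h3"
  by (simp add: hybrid_eq_iff one_hybrid_def h1_def h2_def h3_def)

instantiation hybrid :: times
begin

text \<open>The bilinear extension of the multiplication table of the basis \<open>1, h1, h2, h3\<close>: one
  summand for each ordered pair of basis elements, the vector on the right being their product.\<close>

definition times_hybrid :: "hybrid \<Rightarrow> hybrid \<Rightarrow> hybrid" where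
  "X * Y =
     (hcomp0 X * hcomp0 Y) *\<^sub>R 1
   + (hcomp0 X * hcomp1 Y) *\<^sub>R h1
   + (hcomp0 X * hcomp2 Y) *\<^sub>R h2
   + (hcomp0 X * hcomp3 Y) *\<^sub>R h3
   + (hcomp1 X * hcomp0 Y) *\<^sub>R h1
   + (hcomp1 X * hcomp1 Y) *\<^sub>R (- 1)
   + (hcomp1 X * hcomp2 Y) *\<^sub>R (1 - h3)
   + (hcomp1 X * hcomp3 Y) *\<^sub>R (h1 + h2)
   + (hcomp2 X * hcomp0 Y) *\<^sub>R h2
   + (hcomp2 X * hcomp1 Y) *\<^sub>R (1 + h3)
   + (hcomp2 X * hcomp2 Y) *\<^sub>R 0
   + (hcomp2 X * hcomp3 Y) *\<^sub>R (- h2)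
   + (hcomp3 X * hcomp0 Y) *\<^sub>R h3
   + (hcomp3 X * hcomp1 Y) *\<^sub>R (- h1 - h2)
   + (hcomp3 X * hcomp2 Y) *\<^sub>R h2
   + (hcomp3 X * hcomp3 Y) *\<^sub>R 1"

instance ..

end

lemma hybrid_times_table:
  "h1 * h1 = - 1"   "h1 * h2 = 1 - h3"   "h1 * h3 = h1 + h2"
  "h2 * h1 = 1 + h3"   "h2 * h2 = 0"   "h2 * h3 = - h2"
  "h3 * h1 = - h1 - h2"   "h3 * h2 = h2"   "h3 * h3 = 1"
  by (simp_all add: times_hybrid_def hybrid_eq_iff one_hybrid_def h1_def h2_def h3_def)

lemma hybrid_times_unit: "1 * X = X" "X * 1 = (X :: hybrid)"
  by (simp_all add: times_hybrid_def hybrid_eq_iff one_hybrid_def h1_def h2_def h3_def)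

lemma hybrid_times_bilinear:
  fixes X :: hybrid
  shows "linear (\<lambda>Y. X * Y)" "linear (\<lambda>Y. Y * X)"
  by (rule linearI;
      simp add: times_hybrid_def hybrid_eq_iff one_hybrid_def h1_def h2_def h3_def algebra_simps)+

definition commutator :: "'a :: {times, minus} \<Rightarrow> 'a \<Rightarrow> 'a" where
  "commutator X Y = X * Y - Y * X"

locale lie_algebra = vector_space scale
  for scale :: "'a :: field \<Rightarrow> 'b :: ab_group_add \<Rightarrow> 'b" +
  fixes bracket :: "'b \<Rightarrow> 'b \<Rightarrow> 'b"
  assumes linear_left: "Vector_Spaces.linear scale scale (\<lambda>x. bracket x y)"
    and linear_right: "Vector_Spaces.linear scale scale (\<lambda>y. bracket x y)"
    and alternating: "bracket x x = 0"
    and jacobi: "bracket x (bracket y z) + bracket y (bracket z x) + bracket z (bracket x y) = 0"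

end

theory Submission
  imports Defs
begin

text \<open>The commutator of any associative real algebra is a Lie bracket
  (\<open>lie_algebra_commutator\<close>), so what is specific to hybrid numbers is that their
  product is associative and bilinear. The coordinate formulas \<open>hcomp_times\<close> reduce
  this to polynomial identities over the reals.\<close>

lemma hcomp_times:
  "hcomp0 (X * Y) = hcomp0 X * hcomp0 Y - hcomp1 X * hcomp1 Y + hcomp1 X * hcomp2 Y
     + hcomp2 X * hcomp1 Y + hcomp3 X * hcomp3 Y"
  "hcomp1 (X * Y) = hcomp0 X * hcomp1 Y + hcomp1 X * hcomp0 Y + hcomp1 X * hcomp3 Y
     - hcomp3 X * hcomp1 Y"
  "hcomp2 (X * Y) = hcomp0 X * hcomp2 Y + hcomp2 X * hcomp0 Y + hcomp1 X * hcomp3 Y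
     - hcomp3 X * hcomp1 Y - hcomp2 X * hcomp3 Y + hcomp3 X * hcomp2 Y"
  "hcomp3 (X * Y) = hcomp0 X * hcomp3 Y + hcomp3 X * hcomp0 Y - hcomp1 X * hcomp2 Y
     + hcomp2 X * hcomp1 Y"
  by (simp_all add: times_hybrid_def one_hybrid_def h1_def h2_def h3_def)

instance hybrid :: real_algebra_1
proof
  fix X Y Z :: hybrid and r :: real
  \<comment> \<open>Associativity is the one law that depends on the particular multiplication
    table; distributivity and compatibility with scaling hold for any bilinear extension.\<close>
  show "X * Y * Z = X * (Y * Z)"
    by (simp add: hybrid_eq_iff hcomp_times algebra_simps)
  show "(X + Y) * Z = X * Z + Y * Z" "X * (Y + Z) = X * Y + X * Z"
    "r *\<^sub>R X * Y = r *\<^sub>R (X * Y)" "X * r *\<^sub>R Y = r *\<^sub>R (X * Y)"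
    by (simp_all add: hybrid_eq_iff hcomp_times algebra_simps)
  show "1 * X = X" "X * 1 = X"
    by (rule hybrid_times_unit)+
  show "(0 :: hybrid) \<noteq> 1"
    by (simp add: hybrid_eq_iff one_hybrid_def)
qed

lemma lie_algebra_commutator:
  "lie_algebra ((*\<^sub>R) :: real \<Rightarrow> 'a :: real_algebra \<Rightarrow> 'a) commutator"
proof unfold_locales
  fix x y z :: 'a
  show "commutator x x = 0"
    by (simp add: commutator_def)
  \<comment> \<open>By associativity the sum expands into twelve signed words: each of the six
    orderings of \<open>x\<close>, \<open>y\<close>, \<open>z\<close> occurs twice, with opposite
    signs.\<close>
  show "commutator x (commutator y z) + commutator y (commutator z x)
      + commutator z (commutator x y) = 0"
    by (simp add: commutator_def algebra_simps)
qed (simp_all add: commutator_def algebra_simps)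

theorem theorem3p6: "lie_algebra ((*\<^sub>R) :: real \<Rightarrow> hybrid \<Rightarrow> hybrid) commutator"
  by (rule lie_algebra_commutator)

end
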